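(* Let $\boldsymbol{\lambda}\in\Lambda$. A basic feasible solution to the linear program defining $c(\boldsymbol{\lambda})$ is nondegenerate if it satisfies $\boldsymbol{y}>\boldsymbol{0}$, i.e. $y_i>0$ for all $i\in[N]$.
   Context: Fix an integer $N\ge 1$ and write $[N]=\{1,\dots,N\}$. Costs $c_{(i)}>0$ and $c_{(i,j)}>0$ ($i,j\in[N]$) are given with $c_{(i)}=c_{(i,i)}\le c_{(i,j)}=c_{(j,i)}$ for all $i,j\in[N]$. The parameters $\theta_i\ge 0$ ($i\in[N]$) are given. The domain is the box $\Lambda=[\underline{\boldsymbol{\lambda}},\overline{\boldsymbol{\lambda}}]=\{\boldsymbol{\lambda}\in\mathbb{R}^N:\underline{\lambda}_i\le\lambda_i\le\overline{\lambda}_i\ \forall i\}$ with $\underline{\lambda}_i>0$ for all $i$. For $\boldsymbol{\lambda}\in\Lambda$, $c(\boldsymbol{\lambda})$ is the optimal value of the linear program in variables $\boldsymbol{x}=(x_{i,j})_{i,j\in[N]}$, $\boldsymbol{y}=(y_i)_{i\in[N]}$: minimize $\sum_{i,j\in[N]}c_{(i,j)}x_{i,j}+\sum_{i\in[N]}c_{(i)}y_i$ subject to $\sum_{j\in[N]}x_{j,i}+\sum_{j\in[N]}x_{i,j}+y_i=\lambda_i$ for all $i\in[N]$; $\theta_i x_{i,j}\le\lambda_j y_i$ for all $i,j\in[N]$; $x_{i,j}\ge 0$ for all $i,j\in[N]$; $y_i\ge 0$ for all $i\in[N]$. Basic feasible solutions are understood for the standard form of this program obtained by adding slack variables $\delta_{i,j}\ge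 0$ and writing $\theta_i x_{i,j}+\delta_{i,j}=\lambda_j y_i$ for all $i,j\in[N]$; it has $2N^2+N$ nonnegative variables and $N^2+N$ equality constraints. A basic feasible solution is nondegenerate if all $N^2+N$ basic variables are strictly positive (equivalently, exactly $N^2$ variables are zero). *)

theory Defs
  imports "HOL-Analysis.Analysis"
begin

text \<open>
  Linear programs in standard form: minimize \<open>cost \<bullet> z\<close> subject to \<open>mat *v z = rhs\<close>, \<open>z \<ge> 0\<close>.
  Constraints are indexed by \<open>'m\<close>, variables by \<open>'v\<close>.
\<close>

record ('m, 'v) std_lp =
  lp_mat :: "real ^ 'v ^ 'm"
  lp_rhs :: "real ^ 'm"
  lp_cost :: "real ^ 'v"

definition lp_feasible :: "('m::finite, 'v::finite) std_lp \<Rightarrow> real ^ 'v \<Rightarrow> bool" where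
  "lp_feasible P z \<longleftrightarrow> lp_mat P *v z = lp_rhs P \<and> (\<forall>v. 0 \<le> z $ v)"

text \<open>
  The injectivity condition makes the columns independent as a family: two equal columns
  cannot both be basic.
\<close>

definition lp_basis :: "('m::finite, 'v::finite) std_lp \<Rightarrow> 'v set \<Rightarrow> bool" where
  "lp_basis P B \<longleftrightarrow>
     card B = CARD('m) \<and>
     inj_on (\<lambda>v. column v (lp_mat P)) B \<and>
     independent ((\<lambda>v. column v (lp_mat P)) ` B)"

definition lp_basis_of :: "('m::finite, 'v::finite) std_lp \<Rightarrow> 'v set \<Rightarrow> real ^ 'v \<Rightarrow> bool" where
  "lp_basis_of P B z \<longleftrightarrow> lp_basis P B \<and> (\<forall>v. v \<notin> B \<longrightarrow> z $ v = 0)"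

definition basic_feasible_solution :: "('m::finite, 'v::finite) std_lp \<Rightarrow> real ^ 'v \<Rightarrow> bool" where
  "basic_feasible_solution P z \<longleftrightarrow> lp_feasible P z \<and> (\<exists>B. lp_basis_of P B z)"

text \<open>
  A degenerate basic feasible solution may belong to several bases; nondegeneracy asks for
  positive basic variables with respect to each of them.
\<close>

definition nondegenerate_bfs :: "('m::finite, 'v::finite) std_lp \<Rightarrow> real ^ 'v \<Rightarrow> bool" where
  "nondegenerate_bfs P z \<longleftrightarrow>
     basic_feasible_solution P z \<and> (\<forall>B. lp_basis_of P B z \<longrightarrow> (\<forall>v\<in>B. 0 < z $ v))"

text \<open>
  The index set \<open>[N]\<close> is a finite type \<open>'n\<close>. The variables are
  \<open>x\<^sub>i\<^sub>j\<close> (\<open>XVar i j\<close>), \<open>y\<^sub>i\<close> (\<open>YVar i\<close>) and the slacks \<open>\<delta>\<^sub>i\<^sub>j\<close> (\<open>DVar i j\<close>).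
\<close>

datatype 'n lp_var = XVar 'n 'n | YVar 'n | DVar 'n 'n

datatype 'n lp_row = Balance 'n | Coupling 'n 'n

lemma UNIV_lp_var:
  "(UNIV :: 'n lp_var set) =
     (\<lambda>(i, j). XVar i j) ` UNIV \<union> (YVar ` UNIV \<union> (\<lambda>(i, j). DVar i j) ` UNIV)"
proof -
  have "v \<in> (\<lambda>(i, j). XVar i j) ` UNIV \<union> (YVar ` UNIV \<union> (\<lambda>(i, j). DVar i j) ` UNIV)"
    for v :: "'n lp_var"
    by (cases v) auto
  then show ?thesis by blast
qed

lemma UNIV_lp_row:
  "(UNIV :: 'n lp_row set) = Balance ` UNIV \<union> (\<lambda>(i, j). Coupling i j) ` UNIV"
proof -
  have "r \<in> Balance ` UNIV \<union> (\<lambda>(i, j). Coupling i j) ` UNIV" for r :: "'n lp_row"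
    by (cases r) auto
  then show ?thesis by blast
qed

instance lp_var :: (finite) finite
  by standard (simp add: UNIV_lp_var)

instance lp_row :: (finite) finite
  by standard (simp add: UNIV_lp_row)

lemma sum_lp_var:
  fixes f :: "'n::finite lp_var \<Rightarrow> real"
  shows "(\<Sum>v\<in>UNIV. f v) =
    (\<Sum>i\<in>UNIV. \<Sum>j\<in>UNIV. f (XVar i j)) + (\<Sum>i\<in>UNIV. f (YVar i)) +
    (\<Sum>i\<in>UNIV. \<Sum>j\<in>UNIV. f (DVar i j))"
proof -
  let ?X = "(\<lambda>(i, j). XVar i j) ` (UNIV :: ('n \<times> 'n) set)"
  let ?Y = "YVar ` (UNIV :: 'n set)"
  let ?D = "(\<lambda>(i, j). DVar i j) ` (UNIV :: ('n \<times> 'n) set)"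
  have X: "sum f ?X = (\<Sum>i\<in>UNIV. \<Sum>j\<in>UNIV. f (XVar i j))"
    by (subst sum.reindex) (auto simp: inj_on_def sum.cartesian_product case_prod_beta)
  have Y: "sum f ?Y = (\<Sum>i\<in>UNIV. f (YVar i))"
    by (subst sum.reindex) (auto simp: inj_on_def)
  have D: "sum f ?D = (\<Sum>i\<in>UNIV. \<Sum>j\<in>UNIV. f (DVar i j))"
    by (subst sum.reindex) (auto simp: inj_on_def sum.cartesian_product case_prod_beta)
  have "sum f UNIV = sum f ?X + sum f (?Y \<union> ?D)"
    unfolding UNIV_lp_var by (rule sum.union_disjoint) auto
  also have "sum f (?Y \<union> ?D) = sum f ?Y + sum f ?D"
    by (rule sum.union_disjoint) auto
  finally show ?thesis using X Y D by simp
qed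

lemma card_lp_var: "CARD('n::finite lp_var) = 2 * CARD('n) ^ 2 + CARD('n)"
proof -
  have "real CARD('n lp_var) = (\<Sum>v\<in>(UNIV :: 'n lp_var set). 1)" by simp
  also have "\<dots> = real (2 * CARD('n) ^ 2 + CARD('n))"
    unfolding sum_lp_var by (simp add: power2_eq_square)
  finally show ?thesis by (simp only: of_nat_eq_iff)
qed

lemma card_lp_row: "CARD('n::finite lp_row) = CARD('n) ^ 2 + CARD('n)"
proof -
  let ?B = "Balance ` (UNIV :: 'n set)"
  let ?C = "(\<lambda>(i, j). Coupling i j) ` (UNIV :: ('n \<times> 'n) set)"
  have "card ?B = CARD('n)" by (rule card_image) (auto simp: inj_on_def)
  moreover have "card ?C = CARD('n \<times> 'n)" by (rule card_image) (auto simp: inj_on_def)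
  moreover have "card (?B \<union> ?C) = card ?B + card ?C" by (rule card_Un_disjoint) auto
  ultimately show ?thesis by (simp add: UNIV_lp_row power2_eq_square)
qed

text \<open>
  \<open>Balance i\<close> is \<open>\<Sum>\<^sub>j x\<^sub>j\<^sub>i + \<Sum>\<^sub>j x\<^sub>i\<^sub>j + y\<^sub>i = \<lambda>\<^sub>i\<close> (so \<open>x\<^sub>i\<^sub>i\<close> has coefficient 2);
  \<open>Coupling i j\<close> is \<open>\<theta>\<^sub>i x\<^sub>i\<^sub>j + \<delta>\<^sub>i\<^sub>j = \<lambda>\<^sub>j y\<^sub>i\<close>, the slack form of \<open>\<theta>\<^sub>i x\<^sub>i\<^sub>j \<le> \<lambda>\<^sub>j y\<^sub>i\<close>.
\<close>

fun matching_entry :: "real ^ 'n \<Rightarrow> real ^ 'n \<Rightarrow> 'n::finite lp_row \<Rightarrow> 'n lp_var \<Rightarrow> real" where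
  "matching_entry \<theta> lam (Balance i) (XVar k l) = of_bool (l = i) + of_bool (k = i)"
| "matching_entry \<theta> lam (Balance i) (YVar k) = of_bool (k = i)"
| "matching_entry \<theta> lam (Balance i) (DVar k l) = 0"
| "matching_entry \<theta> lam (Coupling i j) (XVar k l) = (if k = i \<and> l = j then \<theta> $ i else 0)"
| "matching_entry \<theta> lam (Coupling i j) (YVar k) = (if k = i then - lam $ j else 0)"
| "matching_entry \<theta> lam (Coupling i j) (DVar k l) = of_bool (k = i \<and> l = j)"

fun matching_rhs :: "real ^ 'n \<Rightarrow> 'n::finite lp_row \<Rightarrow> real" where
  "matching_rhs lam (Balance i) = lam $ i"
| "matching_rhs lam (Coupling i j) = 0"

fun matching_cost :: "('n \<Rightarrow> real) \<Rightarrow> ('n \<Rightarrow> 'n \<Rightarrow> real) \<Rightarrow> 'n lp_var \<Rightarrow> real" where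
  "matching_cost csingle cpair (XVar i j) = cpair i j"
| "matching_cost csingle cpair (YVar i) = csingle i"
| "matching_cost csingle cpair (DVar i j) = 0"

definition matching_lp ::
    "('n \<Rightarrow> real) \<Rightarrow> ('n \<Rightarrow> 'n \<Rightarrow> real) \<Rightarrow> real ^ 'n \<Rightarrow> real ^ 'n \<Rightarrow>
     ('n::finite lp_row, 'n lp_var) std_lp" where
  "matching_lp csingle cpair \<theta> lam =
     \<lparr> lp_mat = (\<chi> r v. matching_entry \<theta> lam r v),
       lp_rhs = (\<chi> r. matching_rhs lam r),
       lp_cost = (\<chi> v. matching_cost csingle cpair v) \<rparr>"

lemma matching_lp_feasible_iff:
  "lp_feasible (matching_lp csingle cpair \<theta> lam) z \<longleftrightarrow>
     (\<forall>i. (\<Sum>j\<in>UNIV. z $ XVar j i) + (\<Sum>j\<in>UNIV. z $ XVar i j) + z $ YVar i = lam $ i) \<and>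
     (\<forall>i j. \<theta> $ i * z $ XVar i j + z $ DVar i j = lam $ j * z $ YVar i) \<and>
     (\<forall>i j. 0 \<le> z $ XVar i j) \<and> (\<forall>i. 0 \<le> z $ YVar i) \<and> (\<forall>i j. 0 \<le> z $ DVar i j)"
proof -
  let ?M = "\<chi> r v. matching_entry \<theta> lam r v"
  have ite: "(if P then a else 0) * b = (if P then a * b else 0)" for P and a b :: real
    by simp
  have ite_sum: "(\<Sum>j\<in>(UNIV :: 'n set). if P \<and> Q j then g j else 0) =
      (if P then \<Sum>j\<in>UNIV. if Q j then g j else 0 else 0)" for P Q and g :: "'n \<Rightarrow> real"
    by simp
  have ite_all: "(\<Sum>j\<in>(UNIV :: 'n set). if P then g j else 0) =
      (if P then \<Sum>j\<in>UNIV. g j else 0)" for P and g :: "'n \<Rightarrow> real"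
    by simp
  have bal: "(?M *v z) $ Balance i =
      (\<Sum>j\<in>UNIV. z $ XVar j i) + (\<Sum>j\<in>UNIV. z $ XVar i j) + z $ YVar i" for i
    by (simp add: matrix_vector_mult_def sum_lp_var distrib_right sum.distrib of_bool_def
        ite ite_all cong: if_cong)
  have cpl: "(?M *v z) $ Coupling i j =
      \<theta> $ i * z $ XVar i j - lam $ j * z $ YVar i + z $ DVar i j" for i j
    by (simp add: matrix_vector_mult_def sum_lp_var of_bool_def ite ite_sum cong: if_cong)
  have rows: "(\<forall>r. P r) \<longleftrightarrow> (\<forall>i. P (Balance i)) \<and> (\<forall>i j. P (Coupling i j))"
    for P :: "'n lp_row \<Rightarrow> bool"
    by (metis lp_row.exhaust)
  have vars: "(\<forall>v. P v) \<longleftrightarrow> (\<forall>i j. P (XVar i j)) \<and> (\<forall>i. P (YVar i)) \<and> (\<forall>i j. P (DVar i j))"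
    for P :: "'n lp_var \<Rightarrow> bool"
    by (metis lp_var.exhaust)
  show ?thesis
    unfolding lp_feasible_def matching_lp_def vars
    by (auto simp: vec_eq_iff rows bal cpl algebra_simps)
qed

lemma matching_lp_objective:
  "lp_cost (matching_lp csingle cpair \<theta> lam) \<bullet> z =
     (\<Sum>i\<in>UNIV. \<Sum>j\<in>UNIV. cpair i j * z $ XVar i j) + (\<Sum>i\<in>UNIV. csingle i * z $ YVar i)"
  by (simp add: matching_lp_def inner_vec_def sum_lp_var)

end

theory Submission
  imports Defs
begin

text \<open>
  Each constraint owns a positive variable: \<open>y\<^sub>i\<close> for \<open>Balance i\<close>, and for \<open>Coupling i j\<close>
  one of \<open>x\<^sub>i\<^sub>j\<close>, \<open>\<delta>\<^sub>i\<^sub>j\<close>, because \<open>\<theta>\<^sub>i x\<^sub>i\<^sub>j + \<delta>\<^sub>i\<^sub>j = \<lambda>\<^sub>j y\<^sub>i > 0\<close>.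
  These variables are distinct and nonbasic variables vanish, so a basis, having as many elements
  as there are constraints, consists of exactly these variables.
\<close>

lemma lp_basis_of_pos:
  fixes P :: "('m::finite, 'v::finite) std_lp" and f :: "'m \<Rightarrow> 'v"
  assumes "lp_basis_of P B z" "inj f" "\<And>r. 0 < z $ f r" "v \<in> B"
  shows "0 < z $ v"
proof -
  have "range f \<subseteq> B"
    using assms(1,3) unfolding lp_basis_of_def by (metis image_subsetI less_irrefl)
  \<comment> \<open>Both sides equal \<open>CARD('m)\<close>: the left by injectivity of
    \<open>f\<close>, the right by \<open>lp_basis\<close>.\<close>
  moreover have "card (range f) = card B"
    using assms(1,2) by (simp add: card_image lp_basis_of_def lp_basis_def)
  ultimately have "range f = B"
    by (simp add: card_subset_eq)
  then show ?thesis using assms(3,4) by auto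
qed

theorem proposition3:
  fixes csingle :: "'n::finite \<Rightarrow> real" and cpair :: "'n \<Rightarrow> 'n \<Rightarrow> real"
    and \<theta> lam_lo lam_up lam :: "real ^ 'n" and z :: "real ^ 'n lp_var"
  assumes "\<And>i. 0 < csingle i" and "\<And>i j. 0 < cpair i j"
    and "\<And>i. csingle i = cpair i i" and "\<And>i j. csingle i \<le> cpair i j" and "\<And>i j. cpair i j = cpair j i"
    and "\<And>i. 0 \<le> \<theta> $ i"
    and "\<And>i. 0 < lam_lo $ i"
    and "lam \<in> cbox lam_lo lam_up"
    and "basic_feasible_solution (matching_lp csingle cpair \<theta> lam) z"
    and "\<And>i. 0 < z $ YVar i"
  shows "nondegenerate_bfs (matching_lp csingle cpair \<theta> lam) z"
proof -
  \<comment> \<open>Either variable of a coupling row would do when both are positive; each value of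
    \<open>f\<close> still reveals its row.\<close>
  define f where "f r = (case r of Balance i \<Rightarrow> YVar i
    | Coupling i j \<Rightarrow> if 0 < z $ XVar i j then XVar i j else DVar i j)" for r :: "'n lp_row"
  have "inj f"
    by (rule injI) (auto simp: f_def split: lp_row.splits if_splits)
  have "lp_feasible (matching_lp csingle cpair \<theta> lam) z"
    using assms(9) by (simp add: basic_feasible_solution_def)
  then have coupling: "\<theta> $ i * z $ XVar i j + z $ DVar i j = lam $ j * z $ YVar i"
    and x_nonneg: "0 \<le> z $ XVar i j" for i j
    by (auto simp: matching_lp_feasible_iff)
  have "0 < z $ DVar i j" if "\<not> 0 < z $ XVar i j" for i j
  proof -
    have "0 < lam $ j"
      using assms(7,8) by (meson less_le_trans mem_box_cart(2))
    then have "0 < lam $ j * z $ YVar i"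
      using assms(10) by simp
    \<comment> \<open>The \<theta> term drops out of the coupling equation, so the slack alone
      equals the positive right-hand side.\<close>
    moreover have "z $ XVar i j = 0"
      using that x_nonneg[of i j] by simp
    ultimately show ?thesis
      using coupling[of i j] by simp
  qed
  then have "0 < z $ f r" for r
    using assms(10) by (simp add: f_def split: lp_row.split)
  \<comment> \<open>\<open>f\<close> depends on \<open>z\<close> but not on \<open>B\<close>, so it
    serves every basis of \<open>z\<close>.\<close>
  then show ?thesis
    using assms(9) lp_basis_of_pos[OF _ \<open>inj f\<close>] by (auto simp: nondegenerate_bfs_def)
qed

end
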